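(* Let $n\ge 2$, let $x_1\ge 1$ be an integer and let $x_2,\dots,x_n\ge 0$ be integers. Then $\mathcal{N}(x_1,x_2,\dots,x_n)=x_1$ if and only if $x_2\oplus x_3\oplus\cdots\oplus x_n=0$ and $2^{\lfloor \log_2 x_1\rfloor+1}$ divides each of $x_2,x_3,\dots,x_n$.
   Context: For nonnegative integers, $\oplus$ denotes bitwise xor. For nonnegative integers $x_1,\dots,x_n$ ($n\ge 2$), the Auxiliary Nim position $(x_1,x_2,\dots,x_n)$, i.e. the selective compound of the Nim heap $*x_1$ with the disjunctive sum of the Nim heaps $*x_2,\dots,*x_n$, is the impartial game (normal play) in which a move consists of one of the following: strictly decrease $x_1$ only; strictly decrease exactly one of $x_2,\dots,x_n$ only; or do both simultaneously (strictly decrease $x_1$ and strictly decrease exactly one of $x_2,\dots,x_n$). All heap sizes stay nonnegative integers. $\mathcal{N}(x_1,\dots,x_n)$ denotes the Sprague-Grundy value: $0$ at terminal positions, and otherwise the minimum nonnegative integer not occurring among the Sprague-Grundy values of the positions reachable in one move. *)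

theory Defs
  imports Complex_Main
begin

text \<open>A position \<open>(x\<^sub>1, \<dots>, x\<^sub>n)\<close> is encoded as \<open>(x\<^sub>1, [x\<^sub>2, \<dots>, x\<^sub>n])\<close>.\<close>

type_synonym aux_nim_pos = "nat \<times> nat list"

inductive nim_sum_move :: "nat list \<Rightarrow> nat list \<Rightarrow> bool" where
  "i < length xs \<Longrightarrow> y < xs ! i \<Longrightarrow> nim_sum_move xs (xs[i := y])"

inductive aux_nim_move :: "aux_nim_pos \<Rightarrow> aux_nim_pos \<Rightarrow> bool" where
  first: "x' < x \<Longrightarrow> aux_nim_move (x, xs) (x', xs)"
| rest: "nim_sum_move xs xs' \<Longrightarrow> aux_nim_move (x, xs) (x, xs')"
| both: "x' < x \<Longrightarrow> nim_sum_move xs xs' \<Longrightarrow> aux_nim_move (x, xs) (x', xs')"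

definition mex :: "nat set \<Rightarrow> nat" where
  "mex S = (LEAST k. k \<notin> S)"

lemma nim_sum_move_sum_list: "nim_sum_move xs xs' \<Longrightarrow> sum_list xs' < sum_list xs"
proof (induction rule: nim_sum_move.induct)
  case (1 i xs y)
  have "xs ! i \<le> sum_list xs"
    using 1(1) by (rule elem_le_sum_list)
  then show ?case
    using 1 by (simp add: sum_list_update)
qed

lemma aux_nim_move_decreases:
  "aux_nim_move p q \<Longrightarrow> fst q + sum_list (snd q) < fst p + sum_list (snd p)"
  by (induction rule: aux_nim_move.induct) (auto dest: nim_sum_move_sum_list)

function grundy :: "aux_nim_pos \<Rightarrow> nat" where
  "grundy p = mex (grundy ` {q. aux_nim_move p q})"
  by auto
termination
  by (relation "measure (\<lambda>p. fst p + sum_list (snd p))") (auto dest: aux_nim_move_decreases)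

declare grundy.simps [simp del]

lemma grundy_terminal:
  assumes "\<nexists>q. aux_nim_move p q"
  shows "grundy p = 0"
  using assms by (simp add: grundy.simps[of p] mex_def image_def Least_eq_0)

definition nim_sum :: "nat list \<Rightarrow> nat" where
  "nim_sum xs = foldr xor xs 0"

end

theory Submission
  imports Defs
begin

text \<open>
  Two observations carry the proof.

  First, every option of \<open>(a, xs)\<close> is an option of \<open>(b, xs)\<close> when \<open>a < b\<close>, and \<open>(a, xs)\<close> itself is
  one more. Hence the value is strictly increasing in the first heap (\<open>grundy_strict_mono\<close>).
  It starts at \<open>grundy (0, xs) = nim_sum xs\<close>, by Bouton's theorem, so \<open>a + nim_sum xs\<close> is a lower
  bound for \<open>grundy (a, xs)\<close>. If \<open>grundy (a, xs) = a\<close>, then \<open>nim_sum xs = 0\<close> and there is no slack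
  below \<open>a\<close>: \<open>grundy (v, xs) = v\<close> for all \<open>v \<le> a\<close>. Apply this to the powers of two \<open>v = 2 ^ j \<le> a\<close>.
  If some heap \<open>x\<close> of \<open>xs\<close> had bit \<open>j\<close>, then replacing \<open>x\<close> by the smaller \<open>x XOR 2 ^ j\<close> and emptying
  the first heap would give an option of \<open>(v, xs)\<close> of value \<open>v\<close>, which is absurd. So no heap has
  a bit at or below the leading bit of \<open>a\<close>, which is the divisibility condition.

  Conversely, let \<open>nim_sum xs = 0\<close> and let \<open>2 ^ k\<close> divide every heap, where \<open>a < 2 ^ k\<close>. By induction
  the positions \<open>(v, xs)\<close> with \<open>v < a\<close> realise all values below \<open>a\<close>. An option with a changed Nim
  part \<open>ys\<close> does not have value \<open>a\<close>: decreasing a multiple of \<open>2 ^ k\<close> alters it at some bit at or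
  above \<open>k\<close>, so \<open>nim_sum ys \<ge> 2 ^ k\<close>, and the lower bound above already exceeds \<open>a\<close>.
\<close>

unbundle bit_operations_syntax

section \<open>Minimal excludants\<close>

lemma mex_eqI:
  assumes "\<And>v. v < k \<Longrightarrow> v \<in> S" and "k \<notin> S"
  shows "mex S = k"
  unfolding mex_def
  by (rule Least_equality) (use assms in \<open>auto intro: leI\<close>)

lemma mex_notin:
  assumes "finite S"
  shows "mex S \<notin> S"
  unfolding mex_def using ex_new_if_finite[OF infinite_UNIV_nat assms] by (rule LeastI_ex)

lemma less_mex_in: "v < mex S \<Longrightarrow> v \<in> S"
  unfolding mex_def using not_less_Least by blast

section \<open>Binary expansions and decreasing moves\<close>

lemma xor_self_cancel: "x XOR (x XOR y) = (y :: nat)"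
  by (simp add: xor.assoc[symmetric])

lemma xor_eq_0_iff: "x XOR y = 0 \<longleftrightarrow> x = (y :: nat)"
proof
  assume "x XOR y = 0"
  then show "x = y"
    using xor_self_cancel[of x y] by simp
qed simp

text \<open>Above the leading bit \<open>j\<close> of \<open>d\<close> the numbers \<open>x\<close> and \<open>x XOR d\<close> agree, and at \<open>j\<close> a one becomes
  a zero, so whatever happens below cannot prevent the decrease.\<close>

lemma xor_less_if_bit:
  fixes x d :: nat
  assumes "bit x j" "bit d j" "d < 2 ^ Suc j"
  shows "x XOR d < x"
proof -
  have "\<not> bit (x XOR d) j"
    using assms by (simp add: bit_xor_iff)
  then have "take_bit (Suc j) (x XOR d) = take_bit j (x XOR d)"
    by (simp add: take_bit_Suc_from_most del: take_bit_xor)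
  then have "take_bit (Suc j) (x XOR d) < 2 ^ j"
    by (simp only: take_bit_nat_less_exp)
  moreover have "2 ^ j \<le> take_bit (Suc j) x"
    using assms by (simp add: take_bit_Suc_from_most)
  ultimately have low: "take_bit (Suc j) (x XOR d) < take_bit (Suc j) x"
    by linarith
  have "drop_bit (Suc j) d = 0"
    using assms(3) by (simp add: drop_bit_eq_div del: power_Suc)
  then have high: "drop_bit (Suc j) (x XOR d) = drop_bit (Suc j) x"
    by (simp del: drop_bit_Suc)
  show ?thesis
    using low high by (metis add_strict_left_mono bits_ident)
qed

lemma exists_leading_bit:
  fixes d :: nat
  assumes "d > 0"
  obtains j where "bit d j" "d < 2 ^ Suc j"
proof -
  obtain j where j: "2 ^ j \<le> d" "d < 2 ^ (j + 1)"
    using ex_power_ivl1[of 2 d] assms by auto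
  then have "d div 2 ^ j = 1"
    by (intro div_nat_eqI) auto
  then show ?thesis
    using that[of j] j by (simp add: bit_iff_odd)
qed

lemma xor_ge_if_less_multiple:
  fixes x y :: nat
  assumes "2 ^ k dvd x" "y < x"
  shows "2 ^ k \<le> x XOR y"
proof (rule ccontr)
  assume "\<not> 2 ^ k \<le> x XOR y"
  then have "drop_bit k (x XOR y) = 0"
    by (simp add: drop_bit_eq_div)
  then have "x div 2 ^ k = y div 2 ^ k"
    by (simp add: xor_eq_0_iff drop_bit_eq_div[symmetric])
  then have "x = y div 2 ^ k * 2 ^ k"
    using assms(1) by (metis dvd_div_mult_self)
  then show False
    using assms(2) by (metis div_times_less_eq_dividend not_le)
qed

lemma power_dvd_if_no_low_bits:
  fixes x :: nat
  assumes "\<And>j. j < k \<Longrightarrow> \<not> bit x j"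
  shows "2 ^ k dvd x"
proof -
  have "take_bit k x = 0"
    by (rule bit_eqI) (use assms in \<open>auto simp: bit_take_bit_iff\<close>)
  then show ?thesis
    by (simp add: take_bit_eq_0_iff)
qed

section \<open>The Nim part\<close>

lemma nim_sum_Nil [simp]: "nim_sum [] = 0"
  and nim_sum_Cons [simp]: "nim_sum (x # xs) = x XOR nim_sum xs"
  by (simp_all add: nim_sum_def)

lemma nim_sum_update:
  "i < length xs \<Longrightarrow> nim_sum (xs[i := y]) = nim_sum xs XOR (xs ! i XOR y)"
proof (induction xs arbitrary: i)
  case (Cons x xs)
  show ?case
  proof (cases i)
    case 0
    have "y XOR nim_sum xs = (x XOR x) XOR (y XOR nim_sum xs)"
      by simp
    also have "\<dots> = (x XOR nim_sum xs) XOR (x XOR y)"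
      by (simp only: ac_simps)
    finally show ?thesis
      using 0 by simp
  qed (use Cons in \<open>simp add: ac_simps\<close>)
qed simp

text \<open>Flipping a pattern \<open>d\<close> in the Nim sum by a legal move is possible as soon as some heap
  contains the leading bit of \<open>d\<close>.\<close>

lemma nim_sum_move_xor:
  assumes "x \<in> set xs" "bit x j" "bit d j" "d < 2 ^ Suc j"
  obtains ys where "nim_sum_move xs ys" "nim_sum ys = nim_sum xs XOR d"
proof -
  obtain i where i: "i < length xs" "xs ! i = x"
    using assms(1) by (auto simp: in_set_conv_nth)
  have "nim_sum_move xs (xs[i := x XOR d])"
    using i xor_less_if_bit[OF assms(2-4)] by (auto intro: nim_sum_move.intros)
  moreover have "nim_sum (xs[i := x XOR d]) = nim_sum xs XOR d"
    using i by (simp add: nim_sum_update xor.assoc[symmetric])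
  ultimately show ?thesis
    by (rule that)
qed

lemma bit_nim_sumD: "bit (nim_sum xs) j \<Longrightarrow> \<exists>x \<in> set xs. bit x j"
  by (induction xs) (auto simp: bit_xor_iff)

lemma nim_sum_move_to_smaller:
  assumes "m < nim_sum xs"
  obtains ys where "nim_sum_move xs ys" "nim_sum ys = m"
proof -
  define d where "d = nim_sum xs XOR m"
  have s: "nim_sum xs = m XOR d" and m: "m = nim_sum xs XOR d"
    unfolding d_def by (metis xor.commute xor_self_cancel)+
  have "d > 0"
    using assms s by (cases "d = 0") auto
  then obtain j where j: "bit d j" "d < 2 ^ Suc j"
    by (rule exists_leading_bit)
  \<comment> \<open>If the leading bit of \<open>d\<close> came from \<open>m\<close>, flipping \<open>d\<close> in \<open>m\<close> would make it smaller.\<close>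
  have "\<not> bit m j"
    using xor_less_if_bit[of m j d] j assms s by auto
  then have "bit (nim_sum xs) j"
    using j by (simp add: s bit_xor_iff)
  then obtain x where "x \<in> set xs" "bit x j"
    using bit_nim_sumD by blast
  then show ?thesis
    using nim_sum_move_xor j m that by metis
qed

lemma nim_sum_move_changes: "nim_sum_move xs ys \<Longrightarrow> nim_sum ys \<noteq> nim_sum xs"
proof (induction rule: nim_sum_move.induct)
  case (1 i xs y)
  show ?case
  proof
    assume "nim_sum (xs[i := y]) = nim_sum xs"
    then have "xs ! i XOR y = 0"
      using 1 xor_self_cancel[of "nim_sum xs" "xs ! i XOR y"] by (simp add: nim_sum_update)
    then show False
      using 1 by (simp add: xor_eq_0_iff)
  qed
qed

section \<open>Values of Auxiliary Nim positions\<close>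

lemma finite_nim_sum_moves: "finite {ys. nim_sum_move xs ys}"
proof (rule finite_subset)
  show "{ys. nim_sum_move xs ys} \<subseteq> (\<Union>i<length xs. (\<lambda>y. xs[i := y]) ` {..<xs ! i})"
    by (auto elim!: nim_sum_move.cases)
qed auto

lemma finite_aux_nim_moves: "finite {q. aux_nim_move p q}"
proof (rule finite_subset)
  show "{q. aux_nim_move p q} \<subseteq> {..fst p} \<times> insert (snd p) {ys. nim_sum_move (snd p) ys}"
    by (auto elim!: aux_nim_move.cases)
qed (use finite_nim_sum_moves in auto)

lemma grundy_option_neq: "aux_nim_move p q \<Longrightarrow> grundy q \<noteq> grundy p"
  using mex_notin[OF finite_imageI[OF finite_aux_nim_moves[of p], of grundy]]
  unfolding grundy.simps[of p, symmetric] by (metis imageI mem_Collect_eq)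

lemma grundy_less_option: "v < grundy p \<Longrightarrow> \<exists>q. aux_nim_move p q \<and> grundy q = v"
  using less_mex_in[of v "grundy ` {q. aux_nim_move p q}"] by (auto simp: grundy.simps[of p])

lemma grundy_eqI:
  assumes "\<And>v. v < k \<Longrightarrow> \<exists>q. aux_nim_move p q \<and> grundy q = v"
    and "\<And>q. aux_nim_move p q \<Longrightarrow> grundy q \<noteq> k"
  shows "grundy p = k"
  unfolding grundy.simps[of p] by (rule mex_eqI) (use assms in blast)+

text \<open>Bouton's theorem: an empty first heap leaves ordinary Nim.\<close>

lemma grundy_zero: "grundy (0, xs) = nim_sum xs"
proof (induction xs rule: measure_induct_rule[of sum_list])
  case (less xs)
  have IH: "grundy (0, ys) = nim_sum ys" if "nim_sum_move xs ys" for ys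
    using less nim_sum_move_sum_list[OF that] .
  show ?case
  proof (rule grundy_eqI)
    fix v assume "v < nim_sum xs"
    then show "\<exists>q. aux_nim_move (0, xs) q \<and> grundy q = v"
      using nim_sum_move_to_smaller IH aux_nim_move.rest by metis
  next
    fix q assume "aux_nim_move (0, xs) q"
    then show "grundy q \<noteq> nim_sum xs"
      by cases (use IH nim_sum_move_changes in auto)
  qed
qed

lemma aux_nim_move_mono:
  assumes "aux_nim_move (a, xs) q" "a < b"
  shows "aux_nim_move (b, xs) q"
  using assms(1) by cases (use assms(2) in \<open>auto intro: aux_nim_move.intros\<close>)

text \<open>The values of the options of \<open>(a, xs)\<close> fill everything below \<open>grundy (a, xs)\<close>, and \<open>(b, xs)\<close> has
  all these options and \<open>(a, xs)\<close> itself, so its value exceeds \<open>grundy (a, xs)\<close>.\<close>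

lemma grundy_strict_mono: "strict_mono (\<lambda>a. grundy (a, xs))"
proof (rule strict_monoI)
  fix a b :: nat assume ab: "a < b"
  have "aux_nim_move (b, xs) (a, xs)"
    using ab by (rule aux_nim_move.first)
  then have "grundy (b, xs) \<noteq> grundy (a, xs)"
    using grundy_option_neq by metis
  moreover have "\<not> grundy (b, xs) < grundy (a, xs)"
    using grundy_less_option aux_nim_move_mono[OF _ ab] grundy_option_neq by metis
  ultimately show "grundy (a, xs) < grundy (b, xs)"
    by linarith
qed

lemma grundy_add_le: "grundy (a, xs) + d \<le> grundy (a + d, xs)"
proof (induction d)
  case (Suc d)
  then show ?case
    using strict_monoD[OF grundy_strict_mono, of "a + d" "Suc (a + d)" xs] by simp
qed simp

lemma nim_sum_add_le_grundy: "nim_sum xs + a \<le> grundy (a, xs)"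
  using grundy_add_le[of 0 xs a] by (simp add: grundy_zero)

text \<open>A heap with bit \<open>j\<close> would allow a move to \<open>(0, ys)\<close> with \<open>nim_sum ys = 2 ^ j\<close>.\<close>

lemma no_bit_if_grundy_eq:
  assumes "nim_sum xs = 0" "grundy (2 ^ j, xs) = 2 ^ j" "x \<in> set xs"
  shows "\<not> bit x j"
proof
  assume "bit x j"
  then obtain ys where "nim_sum_move xs ys" "nim_sum ys = 2 ^ j"
    using nim_sum_move_xor[OF assms(3), of j "2 ^ j"] assms(1) by (auto simp: bit_exp_iff)
  then show False
    using grundy_option_neq[OF aux_nim_move.both[of 0 "2 ^ j" xs ys]] assms(2)
    by (simp add: grundy_zero)
qed

lemma heaps_if_grundy_eq:
  assumes "grundy (a, xs) = a"
  shows "nim_sum xs = 0" and "2 ^ k \<le> a \<Longrightarrow> x \<in> set xs \<Longrightarrow> 2 ^ (k + 1) dvd x"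
proof -
  show nim0: "nim_sum xs = 0"
    using nim_sum_add_le_grundy[of xs a] assms by simp
  have tight: "grundy (v, xs) = v" if "v \<le> a" for v
    using grundy_add_le[of v xs "a - v"] nim_sum_add_le_grundy[of xs v] assms that by simp
  show "2 ^ (k + 1) dvd x" if "2 ^ k \<le> a" "x \<in> set xs"
  proof (rule power_dvd_if_no_low_bits)
    fix j assume "j < k + 1"
    then have "(2::nat) ^ j \<le> 2 ^ k"
      by simp
    then have "2 ^ j \<le> a"
      using that(1) by (rule le_trans)
    then show "\<not> bit x j"
      using no_bit_if_grundy_eq[OF nim0 tight that(2)] by simp
  qed
qed

lemma nim_sum_ge_after_move:
  assumes "nim_sum_move xs ys" "nim_sum xs = 0" "\<And>x. x \<in> set xs \<Longrightarrow> 2 ^ k dvd x"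
  shows "2 ^ k \<le> nim_sum ys"
  using assms by cases (simp add: nim_sum_update xor_ge_if_less_multiple)

lemma grundy_eq_if_heaps:
  assumes "nim_sum xs = 0" "\<And>x. x \<in> set xs \<Longrightarrow> 2 ^ k dvd x" "a < 2 ^ k"
  shows "grundy (a, xs) = a"
  using assms(3)
proof (induction a rule: less_induct)
  case (less a)
  have changed: "grundy (b, ys) \<noteq> a" if "nim_sum_move xs ys" for b ys
    using nim_sum_ge_after_move[OF that assms(1,2)] nim_sum_add_le_grundy[of ys b] less.prems
    by simp
  show ?case
  proof (rule grundy_eqI)
    fix v assume "v < a"
    then show "\<exists>q. aux_nim_move (a, xs) q \<and> grundy q = v"
      using less by (intro exI[of _ "(v, xs)"]) (auto intro: aux_nim_move.first)
  next
    fix q assume "aux_nim_move (a, xs) q"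
    then show "grundy q \<noteq> a"
      by cases (use less changed in auto)
  qed
qed

theorem theorem1:
  fixes n x1 :: nat and xs :: "nat list"
  assumes "n \<ge> 2" and "x1 \<ge> 1" and "length xs = n - 1"
  shows "grundy (x1, xs) = x1 \<longleftrightarrow>
    nim_sum xs = 0 \<and> (\<forall>x \<in> set xs. 2 ^ (nat \<lfloor>log 2 (real x1)\<rfloor> + 1) dvd x)"
proof -
  define k where "k = nat \<lfloor>log 2 (real x1)\<rfloor>"
  have "\<lfloor>log 2 (real x1)\<rfloor> = int k"
    using assms(2) by (simp add: k_def)
  then have "2 ^ k \<le> x1" "x1 < 2 ^ (k + 1)"
    using floor_log_nat_eq_powr_iff[of 2 x1 k] assms(2) by simp_all
  then show ?thesis
    using heaps_if_grundy_eq[of x1 xs] grundy_eq_if_heaps[of xs "k + 1" x1]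
    unfolding k_def by blast
qed

end
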